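(* Let $A\in\mathbb{R}^{m\times n}$ have full column rank, $b\in\mathbb{R}^m$, and let $W\in\mathbb{R}^{m\times m}$ be (symmetric) positive definite. Let $x=(A^TWA)^{-1}A^TWb$ be the unique solution of the weighted least squares (WLS) problem $\min_{x\in\mathbb{R}^n}(b-Ax)^TW(b-Ax)$ and $r=b-Ax$. Let $L\in\mathbb{R}^{n\times k}$ with $\mathrm{rank}(L)=k$ and let $\Phi,\beta,\xi_L$ be positive real numbers. Then the projected condition number of the WLS problem with respect to the weighted product norm $\|\cdot\|_{WF}$ on the data space and the 2-norm on $\mathbb{R}^k$ (defined in the context) equals each of $$\kappa_{2L\mathcal{F}_{wls1}}(A,b)=\left\|\xi_L^2L^T\left(\tfrac{\|r\|_W^2}{\Phi^2}(A^TWA)^{-2}+\left(\tfrac{\|x\|_2^2}{\Phi^2}+\tfrac{1}{\beta^2}\right)(A^TWA)^{-1}\right)L\right\|_2^{1/2}$$ and $$\kappa_{2L\mathcal{F}_{wls2}}(A,b)=\left\|\xi_LL^T(A^TWA)^{-1}\begin{bmatrix}\frac{\|r\|_W}{\Phi}I_n, & \frac{\zeta}{\Phi\beta}A^TW^{1/2}\end{bmatrix}\right\|_2,$$ where $\|r\|_W=(r^TWr)^{1/2}$, $\zeta=\sqrt{\beta^2\|x\|_2^2+\Phi^2}$, and $W^{1/2}$ is the positive definite square root of $W$.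
   Context: $\mathrm{vec}(A)$ stacks the columns of $A$ and $\mathrm{vec}(A,b)=[\mathrm{vec}(A)^T,b^T]^T$. The weighted product norm is $$\|(A,b)\|_{WF}:=\sqrt{\mathrm{vec}(A,b)^T\,W_{\otimes I}\,\mathrm{vec}(A,b)},\qquad W_{\otimes I}=\begin{bmatrix}I_n\otimes W & 0\\ 0 & W\end{bmatrix}.$$ The solution map near the data is $\mathcal{F}(A,b)=(A^TWA)^{-1}A^TWb$ ($W$ is fixed), $\mathcal{F}_L=L^T\mathcal{F}$. The projected condition number in question is $$\lim_{\delta\to0^+}\ \sup_{0<\|(\Phi\Delta A,\beta\Delta b)\|_{WF}\le\delta}\frac{\xi_L\|\mathcal{F}_L(A+\Delta A,b+\Delta b)-\mathcal{F}_L(A,b)\|_2}{\|(\Phi\Delta A,\beta\Delta b)\|_{WF}}.$$ *)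

theory Defs
  imports "HOL-Analysis.Analysis"
begin

definition posdef :: "real^'m^'m \<Rightarrow> bool" where
  "posdef W \<longleftrightarrow> transpose W = W \<and> (\<forall>v. v \<noteq> 0 \<longrightarrow> v \<bullet> (W *v v) > 0)"

text \<open>The positive definite square root; for positive definite \<open>W\<close> it exists and is unique.\<close>

definition mat_sqrt :: "real^'m^'m \<Rightarrow> real^'m^'m" where
  "mat_sqrt W = (THE S. posdef S \<and> S ** S = W)"

definition spectral_norm :: "real^'n^'m \<Rightarrow> real" where
  "spectral_norm M = onorm (\<lambda>v. M *v v)"

definition wnorm :: "real^'m^'m \<Rightarrow> real^'m \<Rightarrow> real" where
  "wnorm W v = sqrt (v \<bullet> (W *v v))"

text \<open>
  Block constructions use product and sum index types. In \<open>vec_mat A\<close> the pair \<open>(j, i)\<close>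
  (column index first, since columns are stacked) indexes the entry in row \<open>i\<close>, column \<open>j\<close>
  of \<open>A\<close>; the Kronecker product pairs its indices in the same order.
\<close>

definition vec_mat :: "real^'n^'m \<Rightarrow> real^('n \<times> 'm)" where
  "vec_mat A = (\<chi> p. A $ snd p $ fst p)"

definition vec_pair :: "real^'n^'m \<Rightarrow> real^'m \<Rightarrow> real^(('n \<times> 'm) + 'm)" where
  "vec_pair A b = (\<chi> s. case s of Inl p \<Rightarrow> vec_mat A $ p | Inr i \<Rightarrow> b $ i)"

definition kronecker :: "real^'a^'b \<Rightarrow> real^'c^'d \<Rightarrow> real^('a \<times> 'c)^('b \<times> 'd)" where
  "kronecker M N = (\<chi> p q. M $ fst p $ fst q * N $ snd p $ snd q)"

definition block_diag :: "real^'a^'b \<Rightarrow> real^'c^'d \<Rightarrow> real^('a + 'c)^('b + 'd)" where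
  "block_diag M N = (\<chi> s t. case (s, t) of
     (Inl p, Inl q) \<Rightarrow> M $ p $ q
   | (Inr p, Inr q) \<Rightarrow> N $ p $ q
   | _ \<Rightarrow> 0)"

definition block_row :: "real^'a^'n \<Rightarrow> real^'c^'n \<Rightarrow> real^('a + 'c)^'n" where
  "block_row M N = (\<chi> i t. case t of Inl j \<Rightarrow> M $ i $ j | Inr j \<Rightarrow> N $ i $ j)"

definition W_block :: "real^'m^'m \<Rightarrow> real^(('n::finite \<times> 'm) + 'm)^(('n \<times> 'm) + 'm)" where
  "W_block W = block_diag (kronecker (mat 1 :: real^'n^'n) W) W"

definition WF_norm :: "real^'m^'m \<Rightarrow> real^'n^'m \<Rightarrow> real^'m \<Rightarrow> real" where
  "WF_norm W A b = sqrt (vec_pair A b \<bullet> (W_block W *v vec_pair A b))"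

text \<open>
  The solution map \<open>\<F>\<close>. It is meaningful where \<open>A\<close> has full column rank, an open
  condition, so the junk values of \<open>matrix_inv\<close> elsewhere do not affect the limit in
  \<open>proj_cond\<close>.
\<close>

definition wls_map :: "real^'m^'m \<Rightarrow> real^'n^'m \<Rightarrow> real^'m \<Rightarrow> real^'n" where
  "wls_map W A b = (matrix_inv (transpose A ** W ** A) ** transpose A ** W) *v b"

definition proj_wls_map ::
  "real^'k^'n \<Rightarrow> real^'m^'m \<Rightarrow> real^'n^'m \<Rightarrow> real^'m \<Rightarrow> real^'k" where
  "proj_wls_map L W A b = transpose L *v wls_map W A b"

text \<open>
  The supremum is taken in \<^typ>\<open>ereal\<close> because it may be infinite for large \<open>\<delta>\<close>.
\<close>

definition proj_cond_sup ::
  "real^'k^'n \<Rightarrow> real^'m^'m \<Rightarrow> real \<Rightarrow> real \<Rightarrow> real \<Rightarrow> real^'n^'m \<Rightarrow> real^'m \<Rightarrow> real \<Rightarrow> ereal" where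
  "proj_cond_sup L W \<xi> \<Phi> \<beta> A b \<delta> =
     (SUP (dA, db) \<in> {(dA, db). 0 < WF_norm W (\<Phi> *\<^sub>R dA) (\<beta> *\<^sub>R db) \<and>
                              WF_norm W (\<Phi> *\<^sub>R dA) (\<beta> *\<^sub>R db) \<le> \<delta>}.
        ereal (\<xi> * norm (proj_wls_map L W (A + dA) (b + db) - proj_wls_map L W A b)
               / WF_norm W (\<Phi> *\<^sub>R dA) (\<beta> *\<^sub>R db)))"

definition proj_cond ::
  "real^'k^'n \<Rightarrow> real^'m^'m \<Rightarrow> real \<Rightarrow> real \<Rightarrow> real \<Rightarrow> real^'n^'m \<Rightarrow> real^'m \<Rightarrow> ereal" where
  "proj_cond L W \<xi> \<Phi> \<beta> A b = Lim (at_right 0) (proj_cond_sup L W \<xi> \<Phi> \<beta> A b)"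

text \<open>The limit exists unconditionally, since the supremum is monotone in \<open>\<delta>\<close>.\<close>

lemma proj_cond_sup_mono:
  assumes "\<delta> \<le> \<epsilon>"
  shows "proj_cond_sup L W \<xi> \<Phi> \<beta> A b \<delta> \<le> proj_cond_sup L W \<xi> \<Phi> \<beta> A b \<epsilon>"
  unfolding proj_cond_sup_def using assms by (intro SUP_subset_mono) auto

lemma tendsto_proj_cond:
  "(proj_cond_sup L W \<xi> \<Phi> \<beta> A b \<longlongrightarrow> proj_cond L W \<xi> \<Phi> \<beta> A b) (at_right 0)"
proof -
  let ?f = "proj_cond_sup L W \<xi> \<Phi> \<beta> A b"
  have "(?f \<longlongrightarrow> (INF \<delta>\<in>{0<..}. ?f \<delta>)) (at_right 0)"
  proof (rule order_tendstoI)
    fix a assume a: "a < (INF \<delta>\<in>{0<..}. ?f \<delta>)"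
    have "a < ?f \<delta>" if "\<delta> > 0" for \<delta>
      using a that by (meson INF_lower greaterThan_iff less_le_trans)
    then show "\<forall>\<^sub>F \<delta> in at_right 0. a < ?f \<delta>"
      by (auto simp: eventually_at_right_field intro: exI[of _ 1])
  next
    fix a assume "(INF \<delta>\<in>{0<..}. ?f \<delta>) < a"
    then obtain \<epsilon> where "\<epsilon> > 0" "?f \<epsilon> < a"
      by (auto simp: INF_less_iff)
    then show "\<forall>\<^sub>F \<delta> in at_right 0. ?f \<delta> < a"
      unfolding eventually_at_right_field
      by (meson less_imp_le proj_cond_sup_mono le_less_trans)
  qed
  moreover from this have "proj_cond L W \<xi> \<Phi> \<beta> A b = (INF \<delta>\<in>{0<..}. ?f \<delta>)"
    unfolding proj_cond_def by (intro tendsto_Lim) auto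
  ultimately show ?thesis by simp
qed

definition wls_objective :: "real^'m^'m \<Rightarrow> real^'n^'m \<Rightarrow> real^'m \<Rightarrow> real^'n \<Rightarrow> real" where
  "wls_objective W A b y = (b - A *v y) \<bullet> (W *v (b - A *v y))"

lemma wls_map_unique_minimizer:
  fixes A :: "real^'n^'m"
  assumes rank: "rank A = CARD('n)" and W: "posdef W" and ne: "y \<noteq> wls_map W A b"
  shows "wls_objective W A b (wls_map W A b) < wls_objective W A b y"
proof -
  let ?G = "transpose A ** W ** A"
  define x where "x = wls_map W A b"
  define r where "r = b - A *v x"
  define d where "d = A *v (x - y)"
  have sym: "u \<bullet> (W *v v) = (W *v u) \<bullet> v" for u v
    using W by (metis dot_lmul_matrix posdef_def transpose_matrix_vector)
  have inj: "inj ((*v) A)"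
    using rank by (simp add: full_rank_injective)
  have pos: "(A *v z) \<bullet> (W *v (A *v z)) > 0" if "z \<noteq> 0" for z
    using W that inj unfolding posdef_def
    by (metis injD matrix_vector_mult_0_right)
  have "z = 0" if "?G *v z = 0" for z
  proof (rule ccontr)
    assume "z \<noteq> 0"
    have "(A *v z) \<bullet> (W *v (A *v z)) = z \<bullet> (?G *v z)"
      by (metis dot_lmul_matrix inner_commute matrix_vector_mul_assoc transpose_matrix_vector)
    with that pos[OF \<open>z \<noteq> 0\<close>] show False by simp
  qed
  then have "invertible ?G"
    by (meson matrix_left_invertible_ker invertible_left_inverse)
  then have Ginv: "?G ** matrix_inv ?G = mat 1"
    unfolding invertible_def matrix_inv_def by (rule someI2_ex) simp
  have "?G *v x = transpose A *v (W *v b)"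
    unfolding x_def wls_map_def
    by (simp add: matrix_vector_mul_assoc matrix_mul_assoc Ginv)
  then have normal: "transpose A *v (W *v r) = 0"
    by (simp add: r_def matrix_vector_mult_diff_distrib matrix_vector_mul_assoc matrix_mul_assoc)
  have ortho: "d \<bullet> (W *v r) = 0"
    using normal unfolding d_def
    by (metis dot_lmul_matrix inner_commute inner_zero_left transpose_matrix_vector)
  have "b - A *v y = r + d"
    by (simp add: r_def d_def matrix_vector_mult_diff_distrib)
  then have "wls_objective W A b y = r \<bullet> (W *v r) + 2 * (d \<bullet> (W *v r)) + d \<bullet> (W *v d)"
    using sym[of r d] by (simp add: wls_objective_def matrix_vector_right_distrib
        inner_add_left inner_add_right inner_commute)
  moreover have "d \<bullet> (W *v d) > 0"
    using pos ne by (simp add: d_def x_def)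
  ultimately have "r \<bullet> (W *v r) < wls_objective W A b y"
    using ortho by simp
  then show ?thesis by (simp add: wls_objective_def r_def x_def)
qed

definition kappa_wls1 ::
  "real^'k^'n \<Rightarrow> real^'m^'m \<Rightarrow> real \<Rightarrow> real \<Rightarrow> real \<Rightarrow> real^'n^'m \<Rightarrow> real^'n \<Rightarrow> real^'m \<Rightarrow> real" where
  "kappa_wls1 L W \<xi> \<Phi> \<beta> A x r =
     (let Gi = matrix_inv (transpose A ** W ** A) in
      sqrt (spectral_norm (\<xi>\<^sup>2 *\<^sub>R (transpose L **
        (((wnorm W r)\<^sup>2 / \<Phi>\<^sup>2) *\<^sub>R (Gi ** Gi) + ((norm x)\<^sup>2 / \<Phi>\<^sup>2 + 1 / \<beta>\<^sup>2) *\<^sub>R Gi) ** L))))"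

definition kappa_wls2 ::
  "real^'k^'n \<Rightarrow> real^'m^'m \<Rightarrow> real \<Rightarrow> real \<Rightarrow> real \<Rightarrow> real^'n^'m \<Rightarrow> real^'n \<Rightarrow> real^'m \<Rightarrow> real" where
  "kappa_wls2 L W \<xi> \<Phi> \<beta> A x r =
     (let \<zeta> = sqrt (\<beta>\<^sup>2 * (norm x)\<^sup>2 + \<Phi>\<^sup>2) in
      spectral_norm (\<xi> *\<^sub>R (transpose L ** matrix_inv (transpose A ** W ** A) **
        block_row ((wnorm W r / \<Phi>) *\<^sub>R mat 1) ((\<zeta> / (\<Phi> * \<beta>)) *\<^sub>R (transpose A ** mat_sqrt W)))))"

end

theory Submission
  imports Defs
begin

text \<open>
  With \<open>S = W\<^sup>1\<^sup>/\<^sup>2\<close>, the map \<open>T (E, e) = (\<Phi> S E, \<beta> S e)\<close> turns the weighted product norm into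
  the Euclidean norm. The normal equations show that the solution map has the derivative
  \<open>(E, e) \<mapsto> (A\<^sup>T W A)\<^sup>-\<^sup>1 (E\<^sup>T W r + A\<^sup>T W (e - E x))\<close> at the data. After projection by \<open>L\<^sup>T\<close> and
  scaling by \<open>\<xi>\<close> this is \<open>p\<^sup>* T\<close> with
  \<open>p v = (\<xi>/\<Phi> (S r u\<^sup>T - S A u x\<^sup>T), \<xi>/\<beta> S A u)\<close>, \<open>u = (A\<^sup>T W A)\<^sup>-\<^sup>1 L v\<close>, and so the condition number is
  the operator norm of \<open>p\<close>. Because \<open>A\<^sup>T W r = 0\<close>, the two rank-one terms are orthogonal; hence
  \<open>p\<^sup>* p\<close> is the matrix inside the norm in the first formula, and the transpose of the matrix in
  the second formula satisfies \<open>norm (B\<^sup>T v) = norm (p v)\<close>.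
\<close>

section \<open>Square roots of positive definite matrices\<close>

text \<open>A maximizer \<open>e\<close> of the quadratic form on the unit sphere of
  \<open>V\<close> works: its first-order condition makes \<open>T e - c *\<^sub>R e\<close>
  orthogonal to every \<open>y\<close> in \<open>V\<close> with \<open>e \<bullet> y = 0\<close>.
  This vector is itself such a \<open>y\<close>, so it vanishes.\<close>

lemma symmetric_maximizer_eigenvector:
  fixes T :: "'a::euclidean_space \<Rightarrow> 'a"
  assumes T: "linear T" and sym: "\<And>u v. T u \<bullet> v = u \<bullet> T v"
    and V: "subspace V" "T ` V \<subseteq> V" "V \<noteq> {0}"
  obtains e c where "e \<in> V" "norm e = 1" "T e = c *\<^sub>R e"
proof -
  obtain w where w: "w \<in> V" "w \<noteq> 0"
    using V subspace_0 by blast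
  let ?K = "sphere 0 1 \<inter> V"
  have "compact ?K"
    using V(1) closed_subspace by (intro compact_Int_closed) auto
  moreover have "(1 / norm w) *\<^sub>R w \<in> ?K"
    using w V(1) by (simp add: subspace_scale)
  moreover have "continuous_on ?K (\<lambda>v. v \<bullet> T v)"
    by (intro continuous_intros linear_continuous_on linear_conv_bounded_linear[THEN iffD1] T)
  ultimately obtain e where e: "e \<in> ?K" and max: "\<And>v. v \<in> ?K \<Longrightarrow> v \<bullet> T v \<le> e \<bullet> T e"
    using continuous_attains_sup[of ?K "\<lambda>v. v \<bullet> T v"] by (metis empty_iff)
  define c where "c = e \<bullet> T e"
  have ee: "e \<bullet> e = 1" and eV: "e \<in> V"
    using e by (auto simp: dot_square_norm)
  have quad: "v \<bullet> T v \<le> c * (v \<bullet> v)" if "v \<in> V" for v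
  proof (cases "v = 0")
    case True
    then show ?thesis by (simp add: linear_0[OF T])
  next
    case False
    have "((1 / norm v) *\<^sub>R v) \<bullet> T ((1 / norm v) *\<^sub>R v) \<le> c"
      unfolding c_def using False that V(1) by (intro max) (simp add: subspace_scale)
    then have "(v \<bullet> T v) / (norm v)\<^sup>2 \<le> c"
      by (simp add: linear_scale[OF T] power2_eq_square)
    then show ?thesis
      using False by (simp add: field_simps dot_square_norm)
  qed
  have "e \<bullet> T y = 0" if y: "y \<in> V" "e \<bullet> y = 0" for y
  proof (rule ccontr)
    define p where "p = e \<bullet> T y"
    define q where "q = c * (y \<bullet> y) - y \<bullet> T y"
    assume "e \<bullet> T y \<noteq> 0"
    then have "p \<noteq> 0" by (simp add: p_def)
    have q0: "q \<ge> 0"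
      using quad[OF y(1)] by (simp add: q_def)
    \<comment> \<open>Apply \<open>quad\<close> to \<open>e + t *\<^sub>R y\<close>: the constant
      terms cancel, and a term linear in \<open>t\<close> is left against a quadratic one.\<close>
    have *: "2 * t * p \<le> t\<^sup>2 * q" for t
    proof -
      have "(e + t *\<^sub>R y) \<bullet> T (e + t *\<^sub>R y) \<le> c * ((e + t *\<^sub>R y) \<bullet> (e + t *\<^sub>R y))"
        using y eV V(1) by (intro quad) (simp add: subspace_add subspace_scale)
      moreover have "y \<bullet> T e = p"
        using sym[of e y] by (simp add: p_def inner_commute)
      ultimately show ?thesis
        using y(2) ee
        by (simp add: linear_add[OF T] linear_scale[OF T] inner_add_left inner_add_right
            inner_commute[of y e] p_def[symmetric] c_def[symmetric] q_def algebra_simps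
            power2_eq_square)
    qed
    \<comment> \<open>This \<open>t\<close> turns \<open>*\<close> into
      \<open>t\<^sup>2 * (q + 2) \<le> 0\<close>; the added 1 keeps the denominator positive when
      \<open>q = 0\<close>.\<close>
    define t where "t = p / (q + 1)"
    have p: "p = t * (q + 1)" and "t \<noteq> 0"
      using q0 \<open>p \<noteq> 0\<close> by (auto simp: t_def)
    then have "t\<^sup>2 * (q + 2) \<le> 0"
      using *[of t] by (simp add: algebra_simps power2_eq_square)
    moreover have "t\<^sup>2 * (q + 2) > 0"
      using \<open>t \<noteq> 0\<close> q0 by simp
    ultimately show False by simp
  qed
  then have perp: "(T e - c *\<^sub>R e) \<bullet> y = 0" if "y \<in> V" "e \<bullet> y = 0" for y
    using that sym[of e y] by (simp add: inner_diff_left)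
  have "(T e - c *\<^sub>R e) \<bullet> (T e - c *\<^sub>R e) = 0"
    using V eV ee by (intro perp)
      (auto simp: c_def inner_diff_right intro!: subspace_diff subspace_scale)
  then have "T e = c *\<^sub>R e" by simp
  with that eV ee show ?thesis
    by (metis norm_eq_1)
qed

text \<open>Induction on the dimension: split off a unit eigenvector \<open>e\<close>. By symmetry,
  \<open>T\<close> maps the orthogonal complement of \<open>e\<close> in \<open>V\<close> into
  itself.\<close>

lemma symmetric_eigenbasis_subspace:
  fixes T :: "'a::euclidean_space \<Rightarrow> 'a"
  assumes T: "linear T" and sym: "\<And>u v. T u \<bullet> v = u \<bullet> T v"
  shows "subspace V \<Longrightarrow> T ` V \<subseteq> V \<Longrightarrow>
    \<exists>B. pairwise orthogonal B \<and> (\<forall>e\<in>B. norm e = 1 \<and> (\<exists>c. T e = c *\<^sub>R e)) \<and> span B = V"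
proof (induction "dim V" arbitrary: V rule: less_induct)
  case less
  show ?case
  proof (cases "V = {0}")
    case True
    then show ?thesis by (intro exI[of _ "{}"]) auto
  next
    case False
    obtain e c where e: "e \<in> V" "norm e = 1" "T e = c *\<^sub>R e"
      using symmetric_maximizer_eigenvector[OF T sym less.prems False] by metis
    define V' where "V' = V \<inter> {v. e \<bullet> v = 0}"
    have sub: "subspace V'"
      unfolding V'_def using less.prems(1) by (intro subspace_inter subspace_hyperplane)
    have "T ` V' \<subseteq> V'"
    proof safe
      fix v assume "v \<in> V'"
      then show "T v \<in> V'"
        using less.prems(2) sym[of e v] by (auto simp: V'_def e)
    qed
    moreover have "e \<notin> V'"
      using e by (simp add: V'_def dot_square_norm)
    then have "V' \<subset> V"
      using e(1) V'_def by blast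
    then have "dim V' < dim V"
      by (intro dim_psubset) (metis sub less.prems(1) span_eq_iff)
    ultimately obtain B where B: "pairwise orthogonal B"
      "\<forall>e\<in>B. norm e = 1 \<and> (\<exists>c. T e = c *\<^sub>R e)" "span B = V'"
      using less.hyps sub by metis
    have "B \<subseteq> V'"
      using B(3) span_superset by blast
    then have "pairwise orthogonal (insert e B)"
      using B(1) by (auto simp: pairwise_insert orthogonal_def V'_def inner_commute)
    moreover have "span (insert e B) = V"
    proof
      show "span (insert e B) \<subseteq> V"
        using \<open>B \<subseteq> V'\<close> e less.prems(1) by (intro span_minimal) (auto simp: V'_def)
      show "V \<subseteq> span (insert e B)"
      proof
        fix v assume v: "v \<in> V"
        have "v - (e \<bullet> v) *\<^sub>R e \<in> V'"
          using v e less.prems(1)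
          by (auto simp: V'_def inner_diff_right dot_square_norm intro!: subspace_diff subspace_scale)
        then show "v \<in> span (insert e B)"
          using B(3) by (auto simp: span_insert)
      qed
    qed
    ultimately show ?thesis
      using B e by (intro exI[of _ "insert e B"]) auto
  qed
qed

lemma symmetric_matrix_inner:
  fixes M :: "real^'n^'n"
  assumes "transpose M = M"
  shows "(M *v u) \<bullet> v = u \<bullet> (M *v v)"
  by (metis assms dot_lmul_matrix transpose_matrix_vector)

lemma symmetric_matrix_eigenbasis:
  fixes M :: "real^'n^'n"
  assumes "transpose M = M"
  obtains B c where "finite B" "\<And>e. e \<in> B \<Longrightarrow> e \<bullet> e = 1"
    "\<And>e f. \<lbrakk>e \<in> B; f \<in> B; e \<noteq> f\<rbrakk> \<Longrightarrow> e \<bullet> f = 0"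
    "\<And>e. e \<in> B \<Longrightarrow> M *v e = c e *\<^sub>R e" "span B = UNIV"
proof -
  obtain B where B: "pairwise orthogonal B"
      "\<forall>e\<in>B. norm e = 1 \<and> (\<exists>c. M *v e = c *\<^sub>R e)" "span B = UNIV"
    using symmetric_eigenbasis_subspace[of "(*v) M" UNIV] symmetric_matrix_inner[OF assms] by auto
  then obtain c where "\<forall>e\<in>B. M *v e = c e *\<^sub>R e"
    by metis
  moreover have "finite B"
    using B by (intro pairwise_orthogonal_imp_finite)
  ultimately show ?thesis
    using that[of B c] B by (auto simp: norm_eq_1 pairwise_def orthogonal_def)
qed

section \<open>Existence and uniqueness of the positive definite square root\<close>

text \<open>Scale each vector of an orthonormal eigenbasis by the square root of its eigenvalue. The
  form \<open>u \<bullet> T v\<close> is then visibly symmetric and positive, and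
  \<open>T \<circ> T\<close> agrees with \<open>W\<close> on the basis.\<close>

lemma posdef_sqrt_exists:
  fixes W :: "real^'m^'m"
  assumes W: "posdef W"
  shows "\<exists>S. posdef S \<and> S ** S = W"
proof -
  obtain B c where B: "finite B" "\<And>e. e \<in> B \<Longrightarrow> e \<bullet> e = 1"
      "\<And>e f. \<lbrakk>e \<in> B; f \<in> B; e \<noteq> f\<rbrakk> \<Longrightarrow> e \<bullet> f = 0"
      "\<And>e. e \<in> B \<Longrightarrow> W *v e = c e *\<^sub>R e" "span B = UNIV"
    using symmetric_matrix_eigenbasis W unfolding posdef_def by metis
  have cpos: "c e > 0" if "e \<in> B" for e
  proof -
    have "e \<bullet> (W *v e) > 0"
      using B(2)[OF that] W unfolding posdef_def by (metis inner_zero_left zero_neq_one)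
    then show ?thesis
      using B(2,4)[OF that] by simp
  qed
  define T where "T v = (\<Sum>e\<in>B. (sqrt (c e) * (e \<bullet> v)) *\<^sub>R e)" for v
  have T: "linear T"
    unfolding T_def
    by (intro linearI)
      (simp_all add: inner_add_right scaleR_add_left sum.distrib scaleR_sum_right algebra_simps)
  define S where "S = matrix T"
  have S: "S *v v = T v" for v
    unfolding S_def using T by (simp add: matrix_works)
  have inner_T: "u \<bullet> T v = (\<Sum>e\<in>B. sqrt (c e) * (e \<bullet> u) * (e \<bullet> v))" for u v
    unfolding T_def by (auto simp: inner_sum_right inner_commute intro!: sum.cong)
  have "transpose S *v v = S *v v" for v
  proof (rule vector_eq_ldot[THEN iffD1, rule_format])
    fix u
    have "u \<bullet> (transpose S *v v) = (S *v u) \<bullet> v"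
      by (metis dot_lmul_matrix inner_commute transpose_matrix_vector)
    also have "\<dots> = u \<bullet> (S *v v)"
      by (simp add: S inner_T inner_commute[of "T u" v] mult_ac)
    finally show "u \<bullet> (transpose S *v v) = u \<bullet> (S *v v)" .
  qed
  then have "transpose S = S"
    by (simp add: matrix_eq)
  moreover have "v \<bullet> (S *v v) > 0" if "v \<noteq> 0" for v
  proof -
    \<comment> \<open>A vector orthogonal to the whole basis is orthogonal to its span, hence to
      itself.\<close>
    have "\<exists>e\<in>B. e \<bullet> v \<noteq> 0"
    proof (rule ccontr)
      assume "\<not> ?thesis"
      then have "orthogonal v v"
        using B(5) by (intro orthogonal_to_span[of v B v]) (auto simp: orthogonal_def inner_commute)
      with that show False by (simp add: orthogonal_def)
    qed
    then obtain e where "e \<in> B" "e \<bullet> v \<noteq> 0" by blast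
    then show ?thesis
      unfolding S inner_T using B(1) cpos
      by (intro sum_pos2[of B e])
        (auto simp: mult.assoc less_imp_le zero_less_mult_iff linorder_neq_iff)
  qed
  moreover have "T (T f) = W *v f" if f: "f \<in> B" for f
  proof -
    have "T f = (\<Sum>e\<in>B. if e = f then sqrt (c f) *\<^sub>R f else 0)"
      unfolding T_def using B(2,3) f by (intro sum.cong) auto
    then have "T f = sqrt (c f) *\<^sub>R f"
      using B(1) f by simp
    then show ?thesis
      using B(4) cpos f by (simp add: linear_scale[OF T] less_imp_le)
  qed
  then have "T (T v) = W *v v" for v
    using linear_eq_on_span[of "T \<circ> T" "(*v) W" B v] B(5) T
    by (simp add: linear_compose)
  then have "S ** S = W"
    by (simp add: matrix_eq S matrix_vector_mul_assoc[symmetric])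
  ultimately show ?thesis
    by (auto simp: posdef_def)
qed

text \<open>An eigenvector \<open>v\<close> of \<open>S - R\<close> for the eigenvalue \<open>c\<close> satisfies
  \<open>0 = v \<bullet> (S\<^sup>2 - R\<^sup>2) v = c (v \<bullet> S v + v \<bullet> R v)\<close>, so \<open>S - R\<close> has no other eigenvalue than \<open>0\<close>.\<close>

lemma posdef_sqrt_unique:
  fixes S R :: "real^'m^'m"
  assumes S: "posdef S" and R: "posdef R" and eq: "S ** S = R ** R"
  shows "S = R"
proof -
  have tr: "transpose S = S" "transpose R = R"
    using S R by (auto simp: posdef_def)
  then have "transpose (S - R) = S - R"
    by (simp add: transpose_def vec_eq_iff)
  then obtain B c where B: "\<And>e. e \<in> B \<Longrightarrow> e \<bullet> e = 1"
      "\<And>e. e \<in> B \<Longrightarrow> (S - R) *v e = c e *\<^sub>R e" "span B = UNIV"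
    using symmetric_matrix_eigenbasis by metis
  have "S *v e = R *v e" if e: "e \<in> B" for e
  proof -
    have diff: "S *v e - R *v e = c e *\<^sub>R e"
      using B(2)[OF e] by (simp add: matrix_vector_mult_diff_rdistrib)
    have "S *v (S *v e) = R *v (R *v e)"
      by (simp add: matrix_vector_mul_assoc eq)
    then have "e \<bullet> (S *v (S *v e - R *v e)) + e \<bullet> (S *v (R *v e)) = e \<bullet> (R *v (R *v e))"
      by (simp add: matrix_vector_mult_diff_distrib inner_diff_right)
    moreover have "e \<bullet> (S *v (R *v e)) = (S *v e - R *v e) \<bullet> (R *v e) + (R *v e) \<bullet> (R *v e)"
      using symmetric_matrix_inner[OF tr(1)] by (simp add: inner_diff_left)
    moreover have "e \<bullet> (R *v (R *v e)) = (R *v e) \<bullet> (R *v e)"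
      using symmetric_matrix_inner[OF tr(2)] by simp
    ultimately have "c e * (e \<bullet> (S *v e) + e \<bullet> (R *v e)) = 0"
      unfolding diff by (simp add: algebra_simps)
    moreover have "e \<bullet> (S *v e) > 0" "e \<bullet> (R *v e) > 0"
      using S R B(1)[OF e] unfolding posdef_def by (metis inner_zero_left zero_neq_one)+
    ultimately have "c e = 0" by auto
    with diff show ?thesis by simp
  qed
  then have "S *v v = R *v v" for v
    using linear_eq_on_span[of "(*v) S" "(*v) R" B v] B(3) by simp
  then show ?thesis
    by (simp add: matrix_eq)
qed

lemma mat_sqrt:
  assumes "posdef W"
  shows "posdef (mat_sqrt W)" and "mat_sqrt W ** mat_sqrt W = W"
proof -
  have "\<exists>!S. posdef S \<and> S ** S = W"
    using posdef_sqrt_exists[OF assms] posdef_sqrt_unique by metis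
  then have "posdef (mat_sqrt W) \<and> mat_sqrt W ** mat_sqrt W = W"
    unfolding mat_sqrt_def by (rule theI')
  then show "posdef (mat_sqrt W)" and "mat_sqrt W ** mat_sqrt W = W"
    by auto
qed

section \<open>Adjoints and condition numbers\<close>

text \<open>Cauchy-Schwarz for the squared norm of \<open>adjoint f y\<close>, written as
  \<open>f (adjoint f y) \<bullet> y\<close>; then one factor \<open>norm (adjoint f y)\<close>
  cancels.\<close>

lemma norm_adjoint_le:
  fixes f :: "'a::euclidean_space \<Rightarrow> 'b::euclidean_space"
  assumes "linear f"
  shows "norm (adjoint f y) \<le> onorm f * norm y"
proof (cases "adjoint f y = 0")
  case True
  then show ?thesis
    using assms by (simp add: onorm_pos_le linear_conv_bounded_linear)
next
  case False
  have "norm (adjoint f y) * norm (adjoint f y) = f (adjoint f y) \<bullet> y"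
    using adjoint_works[OF assms, of "adjoint f y" y] by (simp add: dot_square_norm power2_eq_square)
  also have "\<dots> \<le> norm (f (adjoint f y)) * norm y"
    by (rule norm_cauchy_schwarz)
  also have "\<dots> \<le> (onorm f * norm (adjoint f y)) * norm y"
    using assms by (intro mult_right_mono onorm) (simp_all add: linear_conv_bounded_linear)
  finally show ?thesis
    using False by (simp add: mult.assoc mult.commute mult.left_commute)
qed

lemma onorm_adjoint:
  fixes f :: "'a::euclidean_space \<Rightarrow> 'b::euclidean_space"
  assumes "linear f"
  shows "onorm (adjoint f) = onorm f"
proof (rule antisym)
  show "onorm (adjoint f) \<le> onorm f"
    by (rule onorm_le) (rule norm_adjoint_le[OF assms])
  show "onorm f \<le> onorm (adjoint f)"
    by (rule onorm_le)
      (metis norm_adjoint_le[OF adjoint_linear[OF assms]] adjoint_adjoint[OF assms])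
qed

text \<open>One direction is submultiplicativity with \<open>onorm_adjoint\<close>; the other is
  Cauchy-Schwarz for \<open>v \<bullet> adjoint f (f v)\<close>, the square of
  \<open>norm (f v)\<close>.\<close>

lemma onorm_adjoint_comp_self:
  fixes f :: "'a::euclidean_space \<Rightarrow> 'b::euclidean_space"
  assumes "linear f"
  shows "onorm (\<lambda>v. adjoint f (f v)) = (onorm f)\<^sup>2"
proof (rule antisym)
  let ?h = "\<lambda>v. adjoint f (f v)"
  have bl: "bounded_linear f" "bounded_linear (adjoint f)"
    using assms adjoint_linear[OF assms] by (simp_all add: linear_conv_bounded_linear)
  then have blh: "bounded_linear ?h"
    by (rule bounded_linear_compose[rotated])
  show "onorm ?h \<le> (onorm f)\<^sup>2"
    using onorm_compose[OF bl(2,1)] by (simp add: onorm_adjoint[OF assms] o_def power2_eq_square)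
  have "norm (f v) \<le> sqrt (onorm ?h) * norm v" for v
  proof -
    have "(norm (f v))\<^sup>2 = v \<bullet> ?h v"
      by (simp add: adjoint_works[OF assms] dot_square_norm)
    also have "\<dots> \<le> norm v * norm (?h v)"
      by (rule norm_cauchy_schwarz)
    also have "\<dots> \<le> norm v * (onorm ?h * norm v)"
      by (intro mult_left_mono onorm[OF blh]) auto
    finally have "(norm (f v))\<^sup>2 \<le> onorm ?h * (norm v)\<^sup>2"
      by (simp add: power2_eq_square mult_ac)
    then show ?thesis
      by (metis real_le_rsqrt real_sqrt_mult real_sqrt_abs abs_norm_cancel)
  qed
  then have "onorm f \<le> sqrt (onorm ?h)"
    by (rule onorm_le)
  then show "(onorm f)\<^sup>2 \<le> onorm ?h"
    by (metis onorm_pos_le bl(1) blh power_mono real_sqrt_pow2)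
qed

text \<open>The factorisation \<open>D = p\<^sup>* T\<close> makes the bound \<open>norm (D h) \<le> onorm p * norm (T h)\<close> sharp.\<close>

lemma tendsto_condition_number:
  fixes f :: "'a::euclidean_space \<Rightarrow> 'b::euclidean_space"
    and T :: "'a \<Rightarrow> 'c::euclidean_space" and p :: "'b \<Rightarrow> 'c"
  assumes der: "(f has_derivative (\<lambda>h. adjoint p (T h))) (at z)"
    and p: "linear p" and T: "linear T" "bij T"
  shows "((\<lambda>\<delta>. SUP h\<in>{h. 0 < norm (T h) \<and> norm (T h) \<le> \<delta>}.
            ereal (norm (f (z + h) - f z) / norm (T h))) \<longlongrightarrow> ereal (onorm p)) (at_right 0)"
    (is "(?s \<longlongrightarrow> _) _")
proof -
  define D where "D h = adjoint p (T h)" for h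
  have bp: "bounded_linear p"
    using p by (simp add: linear_conv_bounded_linear)
  have Dlin: "linear D"
    unfolding D_def using linear_compose[OF T(1) adjoint_linear[OF p]] by (simp add: o_def)
  \<comment> \<open>Injectivity bounds \<open>T\<close> from below, so that a small
    \<open>norm (T h)\<close> forces a small \<open>norm h\<close>.\<close>
  obtain c where c: "c > 0" "\<And>h. c * norm h \<le> norm (T h)"
    using linear_inj_bounded_below_pos[OF T(1)] T(2) by (auto simp: bij_def)
  obtain K where K: "K > 0" "\<And>h. norm (T h) \<le> norm h * K"
    using T(1) bounded_linear.pos_bounded linear_conv_bounded_linear by metis
  have upper: "\<forall>\<^sub>F \<delta> in at_right 0. ?s \<delta> \<le> ereal (onorm p + \<epsilon>)" if "\<epsilon> > 0" for \<epsilon>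
  proof -
    \<comment> \<open>With tolerance \<open>\<epsilon> * c\<close> the Taylor remainder is at most
      \<open>\<epsilon> * norm (T h)\<close>; \<open>\<delta> < c * d\<close> keeps \<open>h\<close>
      within radius \<open>d\<close>.\<close>
    have "\<epsilon> * c > 0"
      using that c by simp
    then obtain d where d: "d > 0"
        "\<And>y. norm (y - z) < d \<Longrightarrow> norm (f y - f z - D (y - z)) \<le> \<epsilon> * c * norm (y - z)"
      using der unfolding has_derivative_at_alt D_def by meson
    have "?s \<delta> \<le> ereal (onorm p + \<epsilon>)" if \<delta>: "0 < \<delta>" "\<delta> < c * d" for \<delta>
    proof (rule SUP_least, clarify)
      fix h assume h: "0 < norm (T h)" "norm (T h) \<le> \<delta>"
      have "norm (f (z + h) - f z) \<le> norm (f (z + h) - f z - D h) + norm (D h)"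
        by (metis norm_triangle_sub add.commute)
      also have "norm (f (z + h) - f z - D h) \<le> \<epsilon> * c * norm h"
      proof -
        have "c * norm h < c * d"
          using c(2)[of h] h \<delta> by linarith
        then show ?thesis
          using c(1) d(2)[of "z + h"] by simp
      qed
      also have "\<epsilon> * c * norm h \<le> \<epsilon> * norm (T h)"
        using \<open>\<epsilon> > 0\<close> c(2)[of h] by (simp add: mult.assoc)
      also have "norm (D h) \<le> onorm p * norm (T h)"
        unfolding D_def by (rule norm_adjoint_le[OF p])
      finally show "ereal (norm (f (z + h) - f z) / norm (T h)) \<le> ereal (onorm p + \<epsilon>)"
        using h by (simp add: field_simps)
    qed
    then show ?thesis
      using c d by (auto simp: eventually_at_right_field intro!: exI[of _ "c * d"])
  qed
  \<comment> \<open>This holds for each positive \<open>\<delta>\<close>: a finite supremum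
    \<open>k\<close> bounds the difference quotients, and shrinking \<open>h\<close> along its ray
    carries the bound over to \<open>D\<close>.\<close>
  have lower: "ereal (onorm p) \<le> ?s \<delta>" if \<delta>: "\<delta> > 0" for \<delta>
  proof (cases "?s \<delta>")
    case PInf
    then show ?thesis by simp
  next
    case MInf
    \<comment> \<open>The supremum is not over the empty set: a basis vector rescaled to
      \<open>norm (T h) = \<delta>\<close> is admissible.\<close>
    obtain b :: 'a where b: "b \<in> Basis" by (meson nonempty_Basis all_not_in_conv)
    have Tb: "norm (T b) > 0"
      using c(1) c(2)[of b] b by (metis mult.right_neutral norm_Basis order_less_le_trans)
    have "ereal (norm (f (z + (\<delta> / norm (T b)) *\<^sub>R b) - f z) / norm (T ((\<delta> / norm (T b)) *\<^sub>R b))) \<le> ?s \<delta>"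
      using Tb \<delta> by (intro SUP_upper) (simp add: linear_scale[OF T(1)])
    then show ?thesis using MInf by simp
  next
    case (real k)
    have ratio: "norm (f (z + h) - f z) \<le> k * norm (T h)" if "norm (T h) \<le> \<delta>" for h
    proof (cases "T h = 0")
      case True
      then have "h = 0"
        using c(1) c(2)[of h] by (simp add: mult_le_0_iff)
      then show ?thesis using True by simp
    next
      case False
      then have "ereal (norm (f (z + h) - f z) / norm (T h)) \<le> ?s \<delta>"
        using that by (intro SUP_upper) auto
      then show ?thesis
        using real False by (simp add: field_simps)
    qed
    have D_le: "norm (D h) \<le> k * norm (T h)" for h
    proof (rule field_le_epsilon)
      fix e :: real assume "e > 0"
      define \<eta> where "\<eta> = e / (norm h + 1)"
      have "\<eta> > 0" using \<open>e > 0\<close> by (simp add: \<eta>_def add_nonneg_pos)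
      then obtain d where d: "d > 0"
          "\<And>y. norm (y - z) < d \<Longrightarrow> norm (f y - f z - D (y - z)) \<le> \<eta> * norm (y - z)"
        using der unfolding has_derivative_at_alt D_def by meson
      \<comment> \<open>The first bound puts \<open>t *\<^sub>R h\<close> within the radius
        \<open>d\<close> of the derivative estimate, the second makes it admissible for
        \<open>ratio\<close>; adding 1 covers \<open>h = 0\<close>.\<close>
      define t where "t = min (d / (norm h + 1) / 2) (\<delta> / (norm (T h) + 1))"
      have t: "t > 0"
        using d \<delta> by (simp add: t_def add_nonneg_pos)
      have "t * norm h < d"
      proof -
        have "t * norm h \<le> (d / (norm h + 1) / 2) * norm h"
          by (intro mult_right_mono) (auto simp: t_def)
        also have "\<dots> < d"
          using d by (simp add: divide_simps add_nonneg_pos)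
        finally show ?thesis .
      qed
      then have "norm (f (z + t *\<^sub>R h) - f z - D (t *\<^sub>R h)) \<le> \<eta> * norm (t *\<^sub>R h)"
        using d(2)[of "z + t *\<^sub>R h"] t by simp
      moreover have "norm (f (z + t *\<^sub>R h) - f z) \<le> k * norm (T (t *\<^sub>R h))"
      proof (rule ratio)
        have "t * norm (T h) \<le> (\<delta> / (norm (T h) + 1)) * norm (T h)"
          by (intro mult_right_mono) (auto simp: t_def)
        also have "\<dots> \<le> \<delta>"
          using \<delta> by (simp add: divide_simps add_nonneg_pos)
        finally show "norm (T (t *\<^sub>R h)) \<le> \<delta>"
          using t by (simp add: linear_scale[OF T(1)])
      qed
      moreover have "norm (D (t *\<^sub>R h)) \<le> norm (f (z + t *\<^sub>R h) - f z) + norm (f (z + t *\<^sub>R h) - f z - D (t *\<^sub>R h))"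
        by (metis norm_minus_commute norm_triangle_sub)
      ultimately have "t * norm (D h) \<le> t * (k * norm (T h) + \<eta> * norm h)"
        using t by (simp add: linear_scale[OF T(1)] linear_scale[OF Dlin] algebra_simps)
      then have "norm (D h) \<le> k * norm (T h) + \<eta> * norm h"
        using t by simp
      moreover have "\<eta> * norm h \<le> e"
        using \<open>e > 0\<close> by (simp add: \<eta>_def divide_simps add_nonneg_pos)
      ultimately show "norm (D h) \<le> k * norm (T h) + e" by linarith
    qed
    have "norm (p v) \<le> k * norm v" for v
    proof (cases "p v = 0")
      case True
      moreover have "k \<ge> 0"
      proof -
        obtain b :: 'a where b: "b \<in> Basis" by (meson nonempty_Basis all_not_in_conv)
        have "norm (T b) > 0"
          using c(1) c(2)[of b] b by (metis mult.right_neutral norm_Basis order_less_le_trans)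
        then show ?thesis
          using D_le[of b] by (metis norm_ge_zero order_trans zero_le_mult_iff not_le)
      qed
      ultimately show ?thesis by simp
    next
      case False
      \<comment> \<open>Surjectivity of \<open>T\<close> supplies the extremal direction, for which
        \<open>v \<bullet> D h\<close> is the square of \<open>norm (p v)\<close>.\<close>
      obtain h where h: "T h = p v"
        using T(2) by (metis bij_pointE)
      have "norm (p v) * norm (p v) = v \<bullet> D h"
        by (simp add: D_def h adjoint_works[OF p] dot_square_norm power2_eq_square)
      also have "\<dots> \<le> norm v * norm (D h)"
        by (rule norm_cauchy_schwarz)
      also have "\<dots> \<le> norm v * (k * norm (p v))"
        using D_le[of h] by (intro mult_left_mono) (auto simp: h)
      finally show ?thesis
        using False by (simp add: mult_ac)
    qed
    then have "onorm p \<le> k"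
      by (rule onorm_le)
    then show ?thesis
      using real by simp
  qed
  show ?thesis
  proof (rule order_tendstoI)
    fix a assume "a < ereal (onorm p)"
    then show "\<forall>\<^sub>F \<delta> in at_right 0. a < ?s \<delta>"
      using lower by (auto simp: eventually_at_right_field intro!: exI[of _ 1] intro: less_le_trans)
  next
    fix a assume "ereal (onorm p) < a"
    \<comment> \<open>An intermediate real \<open>r\<close> gives a finite \<open>\<epsilon>\<close>
      even if \<open>a\<close> is infinite, and turns the weak bound of \<open>upper\<close> into a
      strict one.\<close>
    then obtain r where r: "ereal (onorm p) < ereal r" "ereal r < a"
      using ereal_dense2 by blast
    have "\<forall>\<^sub>F \<delta> in at_right 0. ?s \<delta> \<le> ereal (onorm p + (r - onorm p))"
      using r by (intro upper) simp
    then show "\<forall>\<^sub>F \<delta> in at_right 0. ?s \<delta> < a"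
      by eventually_elim (use r in auto)
  qed
qed

section \<open>The derivative of the solution map\<close>

lemma bounded_bilinear_matrix_vector_mult:
  "bounded_bilinear (\<lambda>(M::real^'n^'m) v. M *v v)"
  unfolding bilinear_conv_bounded_bilinear[symmetric] bilinear_def
  by (auto intro!: linearI simp: matrix_vector_right_distrib matrix_vector_mult_add_rdistrib
      matrix_vector_mult_scaleR scaleR_matrix_vector_assoc)

lemma bounded_bilinear_matrix_matrix_mult:
  "bounded_bilinear (\<lambda>(M::real^'n^'m) (N::real^'k^'n). M ** N)"
  unfolding bilinear_conv_bounded_bilinear[symmetric] bilinear_def
  by (auto intro!: linearI simp: vec_eq_iff matrix_matrix_mult_def distrib_left distrib_right
      sum.distrib sum_distrib_left mult_ac)

lemma bounded_linear_transpose: "bounded_linear (transpose :: real^'n^'m \<Rightarrow> real^'m^'n)"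
  unfolding linear_conv_bounded_linear[symmetric]
  by (auto intro!: linearI simp: vec_eq_iff transpose_def)

lemma matrix_inv_works:
  assumes "invertible M"
  shows "M ** matrix_inv M = mat 1" "matrix_inv M ** M = mat 1"
proof -
  have "M ** matrix_inv M = mat 1 \<and> matrix_inv M ** M = mat 1"
    using assms unfolding invertible_def matrix_inv_def by (rule someI_ex)
  then show "M ** matrix_inv M = mat 1" "matrix_inv M ** M = mat 1" by auto
qed

text \<open>The determinant is continuous, and being nonzero is an open condition.\<close>

lemma eventually_invertible:
  fixes H :: "'a::t2_space \<Rightarrow> real^'n^'n"
  assumes "isCont H z" "invertible (H z)"
  shows "\<forall>\<^sub>F w in nhds z. invertible (H w)"
proof -
  have "isCont (\<lambda>w. det (H w)) z"
    unfolding det_def using assms(1)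
    by (intro continuous_intros) (simp_all add: continuous_component)
  moreover have "det (H z) \<noteq> 0"
    using assms(2) by (simp add: invertible_det_nz)
  ultimately have "\<forall>\<^sub>F w in nhds z. det (H w) \<noteq> 0"
    unfolding eventually_nhds_conv_at isCont_def by (auto intro: tendsto_imp_eventually_ne)
  then show ?thesis
    by (simp add: invertible_det_nz)
qed

text \<open>Since \<open>y z = 0\<close>, variations of \<open>H\<close> only contribute at second order, so that continuity
  of \<open>H\<close> suffices.\<close>

lemma has_derivative_linear_system_solution:
  fixes H :: "'a::euclidean_space \<Rightarrow> real^'n^'n" and y k :: "'a \<Rightarrow> real^'n"
  assumes H: "isCont H z" "invertible (H z)" and y: "(y has_derivative y') (at z)" "y z = 0"
    and sol: "\<forall>\<^sub>F w in nhds z. H w *v k w = y w"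
  shows "(k has_derivative (\<lambda>h. matrix_inv (H z) *v y' h)) (at z)"
proof -
  define P where "P = matrix_inv (H z)"
  have P: "P *v (H z *v v) = v" for v
    using matrix_inv_works(2)[OF H(2)] by (simp add: P_def matrix_vector_mul_assoc)
  obtain C where C: "C > 0" "\<And>v. norm (P *v v) \<le> C * norm v"
    using bounded_linear.pos_bounded[OF matrix_vector_mul_bounded_linear[of P]]
    by (metis mult.commute)
  obtain K where K: "K > 0" "\<And>(M::real^'n^'n) v. norm (M *v v) \<le> norm M * norm v * K"
    using bounded_bilinear.pos_bounded[OF bounded_bilinear_matrix_vector_mult] by metis
  have bl_y': "bounded_linear y'"
    using y(1) by (rule has_derivative_bounded_linear)
  obtain Y where Y: "Y > 0" "\<And>h. norm (y' h) \<le> norm h * Y"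
    using bounded_linear.pos_bounded[OF bl_y'] by metis
  \<comment> \<open>Rewrite the system with the fixed matrix \<open>H z\<close>. The perturbation
    term is at most half of \<open>norm (k w)\<close> and is absorbed on the left, whence the factor
    2.\<close>
  have k_bound: "norm (k w) \<le> 2 * C * norm (y w)"
    if "H w *v k w = y w" "norm (H w - H z) * K * C \<le> 1 / 2" for w
  proof -
    have "H z *v k w = y w - (H w - H z) *v k w"
      by (simp add: that(1) matrix_vector_mult_diff_rdistrib)
    then have "norm (k w) \<le> C * norm (y w - (H w - H z) *v k w)"
      using C(2)[of "H z *v k w"] by (metis P)
    also have "\<dots> \<le> C * (norm (y w) + norm (H w - H z) * norm (k w) * K)"
      using C(1) K(2)[of "H w - H z" "k w"]
      by (intro mult_left_mono) (auto intro: order_trans[OF norm_triangle_ineq4])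
    also have "\<dots> = C * norm (y w) + (norm (H w - H z) * K * C) * norm (k w)"
      by (simp add: algebra_simps)
    also have "\<dots> \<le> C * norm (y w) + (1 / 2) * norm (k w)"
      using that(2) by (intro add_left_mono mult_right_mono) auto
    finally show ?thesis by simp
  qed
  have H_near: "\<forall>\<^sub>F w in nhds z. norm (H w - H z) < \<eta>" if "\<eta> > 0" for \<eta>
    using tendstoD[OF H(1)[unfolded isCont_def tendsto_at_iff_tendsto_nhds] that]
    by (simp add: dist_norm)
  have y_near: "\<forall>\<^sub>F w in nhds z. norm (y w - y' (w - z)) \<le> \<eta> * norm (w - z)" if "\<eta> > 0" for \<eta>
    using y that unfolding has_derivative_at_alt eventually_nhds_metric dist_norm by auto
  have "H z *v k z = 0"
    using eventually_nhds_x_imp_x[OF sol] y(2) by simp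
  then have kz: "k z = 0"
    using P[of "k z"] by simp
  have "\<forall>\<^sub>F w in nhds z. norm (k w - P *v y' (w - z)) \<le> \<epsilon> * norm (w - z)" if "\<epsilon> > 0" for \<epsilon>
  proof -
    \<comment> \<open>The first entry of \<open>\<eta>\<close> makes \<open>k_bound\<close>
      applicable; \<open>\<theta> \<le> 1\<close> then yields
      \<open>norm (k w) \<le> 2 * C * (Y + 1) * norm (w - z)\<close>. The remaining entries make the
      errors from \<open>H\<close> and from \<open>y\<close> contribute half of
      \<open>\<epsilon>\<close> each.\<close>
    define \<eta> where "\<eta> = min (1 / (2 * K * C)) (\<epsilon> / (4 * C\<^sup>2 * K * (Y + 1)))"
    define \<theta> where "\<theta> = min 1 (\<epsilon> / (2 * C))"
    have "\<eta> > 0" "\<theta> > 0"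
      using C K Y that by (auto simp: \<eta>_def \<theta>_def)
    then have "\<forall>\<^sub>F w in nhds z. H w *v k w = y w \<and> norm (H w - H z) < \<eta> \<and>
                 norm (y w - y' (w - z)) \<le> \<theta> * norm (w - z)"
      by (intro eventually_conj sol H_near y_near)
    then show ?thesis
    proof eventually_elim
      case (elim w)
      let ?h = "norm (w - z)"
      have "norm (H w - H z) * (2 * K * C) \<le> 1 / (2 * K * C) * (2 * K * C)"
        using elim C K by (intro mult_right_mono) (auto simp: \<eta>_def)
      then have "norm (H w - H z) * K * C \<le> 1 / 2"
        using C K by simp
      then have k1: "norm (k w) \<le> 2 * C * norm (y w)"
        using elim k_bound by blast
      have "norm (y w) \<le> norm (y w - y' (w - z)) + norm (y' (w - z))"
        by (metis norm_triangle_sub add.commute)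
      also have "\<dots> \<le> 1 * ?h + ?h * Y"
      proof (intro add_mono Y(2))
        have "\<theta> * ?h \<le> 1 * ?h"
          by (intro mult_right_mono) (auto simp: \<theta>_def)
        then show "norm (y w - y' (w - z)) \<le> 1 * ?h"
          using elim by linarith
      qed
      finally have "norm (y w) \<le> (Y + 1) * ?h"
        by (simp add: algebra_simps)
      then have "2 * C * norm (y w) \<le> 2 * C * ((Y + 1) * ?h)"
        using C by (intro mult_left_mono) auto
      then have k2: "norm (k w) \<le> 2 * C * (Y + 1) * ?h"
        using k1 by (simp add: mult.assoc)
      have "k w - P *v y' (w - z) = P *v ((y w - y' (w - z)) - (H w - H z) *v k w)"
        using elim P[of "k w"]
        by (simp add: matrix_vector_mult_diff_rdistrib matrix_vector_mult_diff_distrib)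
      then have "norm (k w - P *v y' (w - z)) \<le> C * (norm (y w - y' (w - z)) + norm ((H w - H z) *v k w))"
        by (metis C order_trans[OF C(2)] mult_left_mono norm_triangle_ineq4 less_imp_le)
      also have "\<dots> \<le> C * (\<epsilon> / (2 * C) * ?h + \<epsilon> / (4 * C\<^sup>2 * K * (Y + 1)) * (2 * C * (Y + 1) * ?h) * K)"
      proof (intro mult_left_mono add_mono)
        have "\<theta> * ?h \<le> \<epsilon> / (2 * C) * ?h"
          by (intro mult_right_mono) (auto simp: \<theta>_def)
        then show "norm (y w - y' (w - z)) \<le> \<epsilon> / (2 * C) * ?h"
          using elim by linarith
        have "norm ((H w - H z) *v k w) \<le> norm (H w - H z) * norm (k w) * K"
          by (rule K(2))
        also have "\<dots> \<le> \<epsilon> / (4 * C\<^sup>2 * K * (Y + 1)) * (2 * C * (Y + 1) * ?h) * K"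
          using elim k2 K C Y that by (intro mult_right_mono mult_mono) (auto simp: \<eta>_def)
        finally show "norm ((H w - H z) *v k w) \<le> \<dots>" .
      qed (use C in auto)
      also have "\<dots> = \<epsilon> * ?h"
      proof -
        obtain M where M: "Y + 1 = M" "M > 0"
          using Y by simp
        show ?thesis
          unfolding M(1) using C K M(2) by (simp add: field_simps power2_eq_square)
      qed
      finally show ?case .
    qed
  qed
  then show ?thesis
    unfolding has_derivative_at_alt
    using bounded_linear_compose[OF matrix_vector_mul_bounded_linear[of P] bl_y']
    by (simp add: kz P_def eventually_nhds_metric dist_norm)
qed

section \<open>Gram matrix, normal equations and the derivative\<close>

lemma inner_transpose_mult: "u \<bullet> (transpose M *v v) = (M *v u) \<bullet> (v :: real^'m)"
  by (metis dot_lmul_matrix inner_commute transpose_matrix_vector)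

text \<open>The kernel is trivial: the quadratic form at \<open>z\<close> is that of
  \<open>W\<close> at \<open>A *v z\<close>, which is nonzero for \<open>z \<noteq> 0\<close> by
  full column rank.\<close>

lemma gram_invertible:
  fixes A :: "real^'n^'m"
  assumes rank: "rank A = CARD('n)" and W: "posdef W"
  shows "invertible (transpose A ** W ** A)"
proof -
  have inj: "inj ((*v) A)"
    using rank by (simp add: full_rank_injective)
  have "z = 0" if z: "(transpose A ** W ** A) *v z = 0" for z
  proof (rule ccontr)
    assume "z \<noteq> 0"
    then have "A *v z \<noteq> 0"
      using inj by (metis injD matrix_vector_mult_0_right)
    then have "(A *v z) \<bullet> (W *v (A *v z)) > 0"
      using W by (simp add: posdef_def)
    moreover have "(A *v z) \<bullet> (W *v (A *v z)) = z \<bullet> ((transpose A ** W ** A) *v z)"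
      by (simp add: inner_transpose_mult matrix_vector_mul_assoc[symmetric]
          del: transpose_matrix_vector)
    ultimately show False
      using z by simp
  qed
  then show ?thesis
    by (meson matrix_left_invertible_ker invertible_left_inverse)
qed

lemma wls_normal_equation:
  fixes A :: "real^'n^'m"
  assumes "invertible (transpose A ** W ** A)"
  shows "transpose A *v (W *v (A *v wls_map W A b)) = transpose A *v (W *v b)"
  by (simp add: wls_map_def matrix_vector_mul_assoc matrix_mul_assoc matrix_inv_works(1)[OF assms])

lemma wls_residual_orthogonal:
  fixes A :: "real^'n^'m"
  assumes "invertible (transpose A ** W ** A)"
  shows "transpose A *v (W *v (b - A *v wls_map W A b)) = 0"
  using wls_normal_equation[OF assms, of b]
  by (simp add: matrix_vector_mult_diff_distrib del: transpose_matrix_vector)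

lemma has_derivative_wls_map:
  fixes A :: "real^'n^'m" and b :: "real^'m"
  assumes inv: "invertible (transpose A ** W ** A)"
  defines "x \<equiv> wls_map W A b"
  defines "r \<equiv> b - A *v x"
  shows "((\<lambda>w. wls_map W (fst w) (snd w)) has_derivative
     (\<lambda>h. matrix_inv (transpose A ** W ** A) *v
       (transpose (fst h) *v (W *v r) + transpose A *v (W *v (snd h - fst h *v x))))) (at (A, b))"
proof -
  define H where "H w = transpose (fst w) ** W ** fst w" for w :: "(real^'n^'m) \<times> (real^'m)"
  define y where "y w = transpose (fst w) *v (W *v (snd w - fst w *v x))"
    for w :: "(real^'n^'m) \<times> (real^'m)"
  define k where "k w = wls_map W (fst w) (snd w) - x" for w :: "(real^'n^'m) \<times> (real^'m)"
  have invH: "invertible (H (A, b))"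
    using inv by (simp add: H_def)
  have dfst: "(fst has_derivative fst) F" and dsnd: "(snd has_derivative snd) F" for F
    by (simp_all add: bounded_linear_imp_has_derivative bounded_linear_fst bounded_linear_snd)
  note mv = bounded_bilinear.FDERIV[OF bounded_bilinear_matrix_vector_mult]
  note lin = bounded_linear.has_derivative
  note mm = bounded_bilinear.FDERIV[OF bounded_bilinear_matrix_matrix_mult]
  have res: "((\<lambda>w. W *v (snd w - fst w *v x)) has_derivative (\<lambda>h. W *v (snd h - fst h *v x))) (at (A, b))"
    by (intro lin[OF matrix_vector_mul_bounded_linear] has_derivative_diff dsnd
        lin[OF bounded_bilinear.bounded_linear_left[OF bounded_bilinear_matrix_vector_mult]] dfst)
  have "isCont H (A, b)"
    unfolding H_def
    by (rule has_derivative_continuous)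
      (rule mm[OF lin[OF bounded_bilinear.bounded_linear_left[OF bounded_bilinear_matrix_matrix_mult]
        lin[OF bounded_linear_transpose dfst]] dfst])
  \<comment> \<open>The normal equations hold wherever the Gram matrix is invertible, hence near the
    data; subtracting \<open>H w *v x\<close> on both sides gives \<open>y w\<close>.\<close>
  moreover from this have "\<forall>\<^sub>F w in nhds (A, b). H w *v k w = y w"
    using eventually_invertible[where H = H and z = "(A, b)"] inv
    unfolding H_def fst_conv
    by (auto elim!: eventually_mono simp: y_def k_def matrix_vector_mult_diff_distrib
        wls_normal_equation matrix_vector_mul_assoc[symmetric] simp del: transpose_matrix_vector)
  moreover have "(y has_derivative (\<lambda>h. transpose (fst h) *v (W *v r) +
                   transpose A *v (W *v (snd h - fst h *v x)))) (at (A, b))"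
    using mv[OF lin[OF bounded_linear_transpose dfst] res]
    by (simp add: y_def[abs_def] r_def add.commute del: transpose_matrix_vector)
  moreover have "y (A, b) = 0"
    using wls_residual_orthogonal[OF inv, of b] by (simp add: y_def x_def)
  ultimately have "(k has_derivative (\<lambda>h. matrix_inv (H (A, b)) *v (transpose (fst h) *v (W *v r) +
                   transpose A *v (W *v (snd h - fst h *v x))))) (at (A, b))"
    using has_derivative_linear_system_solution invH by blast
  then have "((\<lambda>w. k w + x) has_derivative (\<lambda>h. matrix_inv (H (A, b)) *v (transpose (fst h) *v (W *v r) +
                   transpose A *v (W *v (snd h - fst h *v x))))) (at (A, b))"
    by (rule has_derivative_add_const)
  then show ?thesis
    by (simp add: k_def H_def)
qed

section \<open>The condition number of weighted least squares\<close>

lemma sum_UNIV_Plus: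
  fixes f :: "'a::finite + 'b::finite \<Rightarrow> 'c::comm_monoid_add"
  shows "(\<Sum>s\<in>UNIV. f s) = (\<Sum>i\<in>UNIV. f (Inl i)) + (\<Sum>j\<in>UNIV. f (Inr j))"
  using sum.Plus[of UNIV UNIV f] by simp

lemma sum_UNIV_Times:
  fixes f :: "'a::finite \<times> 'b::finite \<Rightarrow> 'c::comm_monoid_add"
  shows "(\<Sum>s\<in>UNIV. f s) = (\<Sum>i\<in>UNIV. \<Sum>j\<in>UNIV. f (i, j))"
  using sum.cartesian_product[of "\<lambda>i j. f (i, j)" UNIV UNIV] by simp

lemma norm_matrix_columns: "(norm (M :: real^'n^'m))\<^sup>2 = (\<Sum>j\<in>UNIV. (norm (column j M))\<^sup>2)"
  by (simp add: power2_norm_eq_inner inner_vec_def column_def) (rule sum.swap)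

lemma inner_square_symmetric:
  fixes S W :: "real^'m^'m"
  assumes "transpose S = S" "S ** S = W"
  shows "u \<bullet> (W *v v) = (S *v u) \<bullet> (S *v v)"
  by (simp add: assms(2)[symmetric] matrix_vector_mul_assoc[symmetric]
      symmetric_matrix_inner[OF assms(1)])

text \<open>The Kronecker factor \<open>mat 1\<close> decouples the columns of \<open>E\<close>.
  Each contributes the squared norm of its image under \<open>S\<close>, and these sum to the
  squared Frobenius norm of \<open>S ** E\<close>.\<close>

lemma WF_norm_sqrt:
  fixes S W :: "real^'m^'m" and E :: "real^'n^'m"
  assumes S: "transpose S = S" "S ** S = W"
  shows "WF_norm W E e = norm (S ** E, S *v e)"
proof -
  have quad: "v \<bullet> (W *v v) = (norm (S *v v))\<^sup>2" for v
    by (simp add: inner_square_symmetric[OF S] power2_norm_eq_inner)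
  have "vec_pair E e \<bullet> (W_block W *v vec_pair E e) =
     (\<Sum>j\<in>UNIV. \<Sum>i\<in>UNIV. E $ i $ j * (\<Sum>j'\<in>UNIV. \<Sum>i'\<in>UNIV. mat 1 $ j $ j' * W $ i $ i' * E $ i' $ j'))
     + (\<Sum>i\<in>UNIV. e $ i * (\<Sum>i'\<in>UNIV. W $ i $ i' * e $ i'))"
    by (simp add: inner_vec_def matrix_vector_mult_def vec_pair_def vec_mat_def W_block_def
        block_diag_def kronecker_def sum_UNIV_Plus sum_UNIV_Times)
  also have "(\<Sum>j\<in>UNIV. \<Sum>i\<in>UNIV. E $ i $ j * (\<Sum>j'\<in>UNIV. \<Sum>i'\<in>UNIV. mat 1 $ j $ j' * W $ i $ i' * E $ i' $ j'))
     = (\<Sum>j\<in>UNIV. column j E \<bullet> (W *v column j E))"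
  proof (intro sum.cong refl)
    fix j
    have "(\<Sum>j'\<in>UNIV. \<Sum>i'\<in>UNIV. mat 1 $ j $ j' * W $ i $ i' * E $ i' $ j')
        = (\<Sum>j'\<in>UNIV. if j = j' then \<Sum>i'\<in>UNIV. W $ i $ i' * E $ i' $ j else 0)" for i
      by (intro sum.cong) (auto simp: mat_def)
    then show "(\<Sum>i\<in>UNIV. E $ i $ j * (\<Sum>j'\<in>UNIV. \<Sum>i'\<in>UNIV. mat 1 $ j $ j' * W $ i $ i' * E $ i' $ j'))
        = column j E \<bullet> (W *v column j E)"
      by (simp add: inner_vec_def matrix_vector_mult_def column_def)
  qed
  also have "\<dots> = (norm (S ** E))\<^sup>2"
    unfolding norm_matrix_columns quad
    by (intro sum.cong) (auto simp: column_def matrix_matrix_mult_def matrix_vector_mult_def)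
  also have "(\<Sum>i\<in>UNIV. e $ i * (\<Sum>i'\<in>UNIV. W $ i $ i' * e $ i')) = (norm (S *v e))\<^sup>2"
    unfolding quad[symmetric] by (simp add: inner_vec_def matrix_vector_mult_def)
  finally show ?thesis
    by (simp add: WF_norm_def norm_prod_def)
qed

definition outer :: "real^'m \<Rightarrow> real^'n \<Rightarrow> real^'n^'m" where
  "outer a c = (\<chi> i j. a $ i * c $ j)"

lemma inner_outer: "M \<bullet> outer a c = a \<bullet> (M *v c)"
  by (simp add: outer_def inner_vec_def matrix_vector_mult_def sum_distrib_left mult_ac)

lemma outer_mult: "outer a c *v d = (c \<bullet> d) *\<^sub>R a"
  by (simp add: outer_def vec_eq_iff inner_vec_def matrix_vector_mult_def sum_distrib_left
      sum_distrib_right mult_ac)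

lemma inner_outer_outer: "outer a c \<bullet> outer a' c' = (a \<bullet> a') * (c \<bullet> c')"
  by (simp add: inner_outer outer_mult inner_commute)

lemma onorm_cong_norm:
  assumes "\<And>v. norm (f v) = norm (g v)"
  shows "onorm f = onorm g"
  using assms by (simp add: onorm_def)

text \<open>Transposing turns the block row into a stacked column, whose squared norm splits over
  the two summands of the index type.\<close>

lemma norm_transpose_block_row:
  fixes M :: "real^'a^'n" and N :: "real^'c^'n"
  shows "(norm (transpose (block_row M N) *v w))\<^sup>2 =
    (norm (transpose M *v w))\<^sup>2 + (norm (transpose N *v w))\<^sup>2"
  by (simp add: power2_norm_eq_inner inner_vec_def sum_UNIV_Plus block_row_def
      vector_matrix_mult_def)

section \<open>Scaling, dual map and the two closed formulas\<close>

locale weighted_least_squares =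
  fixes A :: "real^'n^'m" and b r :: "real^'m" and W :: "real^'m^'m"
    and L :: "real^'k^'n" and x :: "real^'n" and \<Phi> \<beta> \<xi> :: real
  assumes rank_A: "rank A = CARD('n)" and posdef_W: "posdef W"
    and x_eq: "x = wls_map W A b" and r_eq: "r = b - A *v x"
    and pos: "\<Phi> > 0" "\<beta> > 0" "\<xi> > 0"
begin

definition S :: "real^'m^'m" where "S = mat_sqrt W"

definition Gi :: "real^'n^'n" where "Gi = matrix_inv (transpose A ** W ** A)"

lemma S_symmetric: "transpose S = S"
  using mat_sqrt(1)[OF posdef_W] by (simp add: S_def posdef_def)

lemma S_square: "S ** S = W"
  using mat_sqrt(2)[OF posdef_W] by (simp add: S_def)

lemma inner_W: "u \<bullet> (W *v v) = (S *v u) \<bullet> (S *v v)"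
  by (rule inner_square_symmetric[OF S_symmetric S_square])

lemma S_inj: "S *v v = 0 \<Longrightarrow> v = 0"
  using mat_sqrt(1)[OF posdef_W] by (metis S_def inner_zero_right order_less_irrefl posdef_def)

lemma gram_inv: "invertible (transpose A ** W ** A)"
  by (rule gram_invertible[OF rank_A posdef_W])

text \<open>The normal equations in the coordinates given by \<open>S\<close>; they remove the cross
  terms in \<open>inner_dual_map\<close>.\<close>

lemma residual_orthogonal: "(S *v r) \<bullet> (S *v (A *v u)) = 0"
proof -
  have "u \<bullet> (transpose A *v (W *v r)) = 0"
    using wls_residual_orthogonal[OF gram_inv, of b] x_eq r_eq by simp
  then have "(A *v u) \<bullet> (W *v r) = 0"
    by (simp only: inner_transpose_mult)
  then show ?thesis
    using inner_W[of "A *v u" r] by (simp add: inner_commute)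
qed

lemma inner_SA: "(S *v (A *v u)) \<bullet> (S *v (A *v v)) = u \<bullet> ((transpose A ** W ** A) *v v)"
  by (simp add: inner_W[symmetric] inner_transpose_mult matrix_vector_mul_assoc[symmetric]
      del: transpose_matrix_vector)

lemma gram_Gi: "(transpose A ** W ** A) *v (Gi *v v) = v"
  using matrix_inv_works(1)[OF gram_inv] by (simp add: Gi_def matrix_vector_mul_assoc)

text \<open>Both sides are values of the symmetric form \<open>inner_SA\<close> at
  \<open>Gi *v u\<close> and \<open>Gi *v v\<close>.\<close>

lemma Gi_symmetric: "u \<bullet> (Gi *v v) = (Gi *v u) \<bullet> v"
  using inner_SA[of "Gi *v u" "Gi *v v"] inner_SA[of "Gi *v v" "Gi *v u"]
  unfolding gram_Gi by (simp add: inner_commute)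

text \<open>The map \<open>T\<close> of the overview; \<open>dual_map\<close> below is its
  \<open>p\<close>.\<close>

definition scaling :: "(real^'n^'m) \<times> (real^'m) \<Rightarrow> (real^'n^'m) \<times> (real^'m)" where
  "scaling h = (\<Phi> *\<^sub>R (S ** fst h), \<beta> *\<^sub>R (S *v snd h))"

lemma linear_scaling: "linear scaling"
  by (rule linearI)
    (auto simp: scaling_def matrix_add_ldistrib matrix_vector_right_distrib scaleR_add_right
      matrix_scalar_ac matrix_vector_mult_scaleR simp flip: scalar_matrix_assoc)

lemma bij_scaling: "bij scaling"
proof -
  have "h = 0" if "scaling h = 0" for h
  proof -
    have SE: "S ** fst h = 0" and "S *v snd h = 0"
      using that pos by (auto simp: scaling_def zero_prod_def)
    have "S *v (fst h *v v) = 0" for v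
      using SE by (simp add: matrix_vector_mul_assoc)
    then have "fst h *v v = 0 *v v" for v
      using S_inj by (metis matrix_vector_mult_0)
    then have "fst h = 0"
      by (metis matrix_eq)
    then show ?thesis
      using S_inj \<open>S *v snd h = 0\<close> by (simp add: prod_eq_iff)
  qed
  then have "inj scaling"
    using linear_scaling by (simp add: linear_injective_0)
  then show ?thesis
    using linear_scaling by (simp add: bij_def linear_injective_imp_surjective)
qed

lemma WF_norm_scaling: "WF_norm W (\<Phi> *\<^sub>R E) (\<beta> *\<^sub>R e) = norm (scaling (E, e))"
  unfolding WF_norm_sqrt[OF S_symmetric S_square] scaling_def
  by (simp add: matrix_scalar_ac matrix_vector_mult_scaleR flip: scalar_matrix_assoc)

text \<open>The adjoint of the derivative of the scaled projected solution map, expressed in the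
  coordinates in which \<^const>\<open>WF_norm\<close> is Euclidean.\<close>

definition dual_map :: "real^'k \<Rightarrow> (real^'n^'m) \<times> (real^'m)" where
  "dual_map v = (let u = Gi *v (L *v v) in
     ((\<xi> / \<Phi>) *\<^sub>R (outer (S *v r) u - outer (S *v (A *v u)) x), (\<xi> / \<beta>) *\<^sub>R (S *v (A *v u))))"

lemma linear_dual_map: "linear dual_map"
  by (rule linearI)
    (auto simp: dual_map_def Let_def outer_def vec_eq_iff matrix_vector_right_distrib
      matrix_vector_mult_scaleR algebra_simps)

text \<open>This is the factorisation of the derivative that \<open>tendsto_condition_number\<close>
  requires. Tested against \<open>v\<close>, the weights \<open>\<Phi>\<close> and
  \<open>\<beta>\<close> cancel and \<open>inner_W\<close> merges the two factors \<open>S\<close>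
  into \<open>W\<close>.\<close>

lemma adjoint_dual_map_scaling:
  "adjoint dual_map (scaling h) = \<xi> *\<^sub>R (transpose L *v (Gi *v
     (transpose (fst h) *v (W *v r) + transpose A *v (W *v (snd h - fst h *v x)))))"
proof (rule vector_eq_ldot[THEN iffD1, rule_format])
  fix v
  define u where "u = Gi *v (L *v v)"
  have "v \<bullet> adjoint dual_map (scaling h) = scaling h \<bullet> dual_map v"
    by (simp add: adjoint_works[OF linear_dual_map] inner_commute)
  also have "\<dots> = \<xi> * ((S *v r) \<bullet> (S *v (fst h *v u)) - (S *v (A *v u)) \<bullet> (S *v (fst h *v x))
                   + (S *v (A *v u)) \<bullet> (S *v snd h))"
    using pos by (simp add: scaling_def dual_map_def u_def[symmetric] inner_diff_right inner_outer
        matrix_vector_mul_assoc[symmetric] scaleR_matrix_vector_assoc[symmetric]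
        inner_commute[of "S *v snd h"] right_diff_distrib distrib_left)
  also have "\<dots> = \<xi> * (u \<bullet> (transpose (fst h) *v (W *v r) + transpose A *v (W *v (snd h - fst h *v x))))"
    by (simp add: inner_add_right inner_transpose_mult inner_W matrix_vector_mult_diff_distrib
        inner_diff_right inner_commute[of "S *v r"] del: transpose_matrix_vector)
  also have "\<dots> = v \<bullet> (\<xi> *\<^sub>R (transpose L *v (Gi *v
     (transpose (fst h) *v (W *v r) + transpose A *v (W *v (snd h - fst h *v x))))))"
    by (simp add: inner_transpose_mult Gi_symmetric u_def del: transpose_matrix_vector)
  finally show "v \<bullet> adjoint dual_map (scaling h) = v \<bullet> (\<xi> *\<^sub>R (transpose L *v (Gi *v
     (transpose (fst h) *v (W *v r) + transpose A *v (W *v (snd h - fst h *v x))))))" .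
qed

text \<open>Stated for two arguments because the first formula needs the whole bilinear form; the
  second uses only \<open>v = w\<close>. The term in \<open>x\<close> and the vector component share
  one inner product, so their coefficients add.\<close>

lemma inner_dual_map:
  fixes v w
  defines "u \<equiv> Gi *v (L *v v)" and "u' \<equiv> Gi *v (L *v w)"
  shows "dual_map v \<bullet> dual_map w = \<xi>\<^sup>2 * ((wnorm W r)\<^sup>2 / \<Phi>\<^sup>2 * (u \<bullet> u')
    + ((norm x)\<^sup>2 / \<Phi>\<^sup>2 + 1 / \<beta>\<^sup>2) * ((S *v (A *v u)) \<bullet> (S *v (A *v u'))))"
proof -
  have "(wnorm W r)\<^sup>2 = (S *v r) \<bullet> (S *v r)"
    by (simp add: wnorm_def inner_W)
  moreover have "(outer (S *v r) u - outer (S *v (A *v u)) x) \<bullet> (outer (S *v r) u' - outer (S *v (A *v u')) x)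
    = ((S *v r) \<bullet> (S *v r)) * (u \<bullet> u') + (norm x)\<^sup>2 * ((S *v (A *v u)) \<bullet> (S *v (A *v u')))"
    by (simp add: inner_diff_left inner_diff_right inner_outer_outer residual_orthogonal
        residual_orthogonal[unfolded inner_commute[of "S *v r"]] power2_norm_eq_inner)
  ultimately show ?thesis
    unfolding dual_map_def Let_def u_def[symmetric] u'_def[symmetric]
    by (simp add: power2_eq_square[of \<xi>] power2_eq_square[of \<Phi>] power2_eq_square[of \<beta>]
        distrib_left distrib_right)
qed

lemma proj_cond_eq: "proj_cond L W \<xi> \<Phi> \<beta> A b = ereal (onorm dual_map)"
proof -
  \<comment> \<open>Absorbing \<open>\<xi>\<close> into the map makes its difference quotients
    exactly those in \<open>proj_cond_sup\<close>.\<close>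
  define f where "f w = \<xi> *\<^sub>R proj_wls_map L W (fst w) (snd w)"
    for w :: "(real^'n^'m) \<times> (real^'m)"
  have "(f has_derivative (\<lambda>h. adjoint dual_map (scaling h))) (at (A, b))"
    unfolding f_def proj_wls_map_def adjoint_dual_map_scaling Gi_def
    by (intro has_derivative_scaleR_right
        has_derivative_wls_map[OF gram_inv, of b, folded x_eq, folded r_eq]
        bounded_linear.has_derivative[OF matrix_vector_mul_bounded_linear])
  from tendsto_condition_number[OF this linear_dual_map linear_scaling bij_scaling]
  have "((\<lambda>\<delta>. SUP h\<in>{h. 0 < norm (scaling h) \<and> norm (scaling h) \<le> \<delta>}.
      ereal (norm (f ((A, b) + h) - f (A, b)) / norm (scaling h))) \<longlongrightarrow> ereal (onorm dual_map)) (at_right 0)" .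
  also have "(\<lambda>\<delta>. SUP h\<in>{h. 0 < norm (scaling h) \<and> norm (scaling h) \<le> \<delta>}.
      ereal (norm (f ((A, b) + h) - f (A, b)) / norm (scaling h))) = proj_cond_sup L W \<xi> \<Phi> \<beta> A b"
    unfolding proj_cond_sup_def WF_norm_scaling
    using pos by (intro ext SUP_cong)
      (auto simp: f_def norm_scaleR simp flip: scaleR_diff_right)
  finally show ?thesis
    by (rule tendsto_unique[OF trivial_limit_at_right_real tendsto_proj_cond])
qed

lemma kappa_wls1_eq: "kappa_wls1 L W \<xi> \<Phi> \<beta> A x r = onorm dual_map"
proof -
  define M where "M = \<xi>\<^sup>2 *\<^sub>R (transpose L **
    (((wnorm W r)\<^sup>2 / \<Phi>\<^sup>2) *\<^sub>R (Gi ** Gi) + ((norm x)\<^sup>2 / \<Phi>\<^sup>2 + 1 / \<beta>\<^sup>2) *\<^sub>R Gi) ** L)"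
  have "M *v v = adjoint dual_map (dual_map v)" for v
  proof (rule vector_eq_ldot[THEN iffD1, rule_format])
    fix w
    \<comment> \<open>\<open>inner_SA\<close> introduces the Gram matrix, which
      \<open>gram_Gi\<close> cancels against one factor \<open>Gi\<close>; hence a single
      \<open>Gi\<close> in the second term of \<open>M\<close>.\<close>
    have "w \<bullet> (M *v v) = dual_map w \<bullet> dual_map v"
      unfolding inner_dual_map inner_SA gram_Gi
      by (simp add: M_def scaleR_matrix_vector_assoc[symmetric] matrix_vector_mul_assoc[symmetric]
          matrix_vector_mult_add_rdistrib inner_transpose_mult inner_add_right Gi_symmetric
          del: transpose_matrix_vector)
    then show "w \<bullet> (M *v v) = w \<bullet> adjoint dual_map (dual_map v)"
      by (simp add: adjoint_works[OF linear_dual_map])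
  qed
  then have "spectral_norm M = (onorm dual_map)\<^sup>2"
    by (simp add: spectral_norm_def onorm_adjoint_comp_self[OF linear_dual_map])
  moreover have "onorm dual_map \<ge> 0"
    using linear_dual_map by (simp add: onorm_pos_le linear_conv_bounded_linear)
  ultimately show ?thesis
    by (simp add: kappa_wls1_def Gi_def[symmetric] M_def)
qed

text \<open>The vectors \<open>transpose B *v v\<close> and \<open>dual_map v\<close> live in
  different spaces but have equal length, which is all that \<open>onorm\<close> sees;
  \<open>onorm_adjoint\<close> then passes from the transpose to \<open>B\<close>.\<close>

lemma kappa_wls2_eq: "kappa_wls2 L W \<xi> \<Phi> \<beta> A x r = onorm dual_map"
proof -
  define \<zeta> where "\<zeta> = sqrt (\<beta>\<^sup>2 * (norm x)\<^sup>2 + \<Phi>\<^sup>2)"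
  define N where "N = block_row ((wnorm W r / \<Phi>) *\<^sub>R (mat 1 :: real^'n^'n))
    ((\<zeta> / (\<Phi> * \<beta>)) *\<^sub>R (transpose A ** S))"
  define B where "B = \<xi> *\<^sub>R (transpose L ** Gi ** N)"
  have "norm (transpose B *v v) = norm (dual_map v)" for v
  proof -
    define u where "u = Gi *v (L *v v)"
    have "transpose Gi *v w = Gi *v w" for w
      by (rule vector_eq_ldot[THEN iffD1, rule_format])
        (simp add: inner_transpose_mult Gi_symmetric del: transpose_matrix_vector)
    then have "transpose B *v v = \<xi> *\<^sub>R (transpose N *v u)"
      by (simp add: B_def u_def transpose_scalar matrix_transpose_mul
          scaleR_matrix_vector_assoc[symmetric] matrix_vector_mul_assoc[symmetric]
          del: transpose_matrix_vector)
    then have "(norm (transpose B *v v))\<^sup>2 = \<xi>\<^sup>2 * ((wnorm W r / \<Phi>)\<^sup>2 * (norm u)\<^sup>2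
        + (\<zeta> / (\<Phi> * \<beta>))\<^sup>2 * (norm (S *v (A *v u)))\<^sup>2)"
      unfolding N_def
      by (simp add: power_mult_distrib norm_transpose_block_row transpose_scalar
          matrix_transpose_mul S_symmetric scaleR_matrix_vector_assoc[symmetric]
          matrix_vector_mul_assoc[symmetric] power_divide del: transpose_matrix_vector)
    \<comment> \<open>The constant \<open>\<zeta>\<close> is chosen so that one block carries the
      combined weight of the \<open>x\<close> term and the \<open>b\<close> term.\<close>
    also have "(\<zeta> / (\<Phi> * \<beta>))\<^sup>2 = (norm x)\<^sup>2 / \<Phi>\<^sup>2 + 1 / \<beta>\<^sup>2"
      using pos by (simp add: \<zeta>_def power_divide power_mult_distrib field_simps)
    finally have "(norm (transpose B *v v))\<^sup>2 = (norm (dual_map v))\<^sup>2"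
      by (simp add: power2_norm_eq_inner inner_dual_map[of v v] u_def[symmetric] power_divide)
    then show ?thesis
      by simp
  qed
  then have "onorm ((*v) (transpose B)) = onorm dual_map"
    by (rule onorm_cong_norm)
  then have "spectral_norm B = onorm dual_map"
    using onorm_adjoint[of "(*v) B"]
    by (simp add: spectral_norm_def adjoint_matrix del: transpose_matrix_vector)
  then show ?thesis
    by (simp add: kappa_wls2_def Let_def B_def N_def \<zeta>_def S_def Gi_def)
qed

end

theorem theorem4p4:
  fixes A :: "real^'n^'m" and b r :: "real^'m" and W :: "real^'m^'m"
    and L :: "real^'k^'n" and x :: "real^'n" and \<Phi> \<beta> \<xi> :: real
  assumes "rank A = CARD('n)"
    and "posdef W"
    and "x = wls_map W A b"
    and "r = b - A *v x"
    and "rank L = CARD('k)"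
    and "\<Phi> > 0" and "\<beta> > 0" and "\<xi> > 0"
  shows "proj_cond L W \<xi> \<Phi> \<beta> A b = ereal (kappa_wls1 L W \<xi> \<Phi> \<beta> A x r) \<and>
         proj_cond L W \<xi> \<Phi> \<beta> A b = ereal (kappa_wls2 L W \<xi> \<Phi> \<beta> A x r)"
proof -
  interpret weighted_least_squares A b r W L x \<Phi> \<beta> \<xi>
    using assms by unfold_locales
  show ?thesis
    by (simp add: proj_cond_eq kappa_wls1_eq kappa_wls2_eq)
qed

end
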